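(* (Uppersemicontinuity of the spectrum) Let $\alpha,c,\delta>0$ and let $\varepsilon>0$ be given. Then for each $z^0\in\sigma_p(\mathcal A)$ there exist $\eta=\eta_\varepsilon>0$ and $\tau\in(0,\eta)$ such that the set $$\{z^\tau\in\sigma(\mathcal A^\tau):\ |z^\tau-z^0|<\varepsilon\}$$ is nonempty.
   Context: $A$ is a positive self-adjoint operator with compact resolvent on an infinite-dimensional separable Hilbert space $H$ (for instance $H=L^2(\Omega)$ and $A$ the Dirichlet Laplacian $-\Delta$ on a bounded $C^2$ domain $\Omega$). For $\tau>0$ put $b^\tau=\delta+\tau c^2$. On $\mathbb H_0^0=\mathcal D(A^{1/2})\times\mathcal D(A^{1/2})$ (complexified), $\mathcal A(u,v)=(v,\,-\alpha^{-1}A(c^2u+\delta v))$ with domain $\{(u,v)\in\mathbb H_0^0: c^2u+\delta v\in\mathcal D(A^{3/2})\}$. On $\mathbb H_0=\mathcal D(A^{1/2})\times\mathcal D(A^{1/2})\times H$ (complexified), $\mathcal A^\tau(u,v,w)=(v,\,w,\,-\tau^{-1}A(c^2u+b^\tau v)-\tau^{-1}\alpha w)$ with domain $\{(u,v,w)\in\mathbb H_0: w\in\mathcal D(A^{1/2}),\ c^2u+b^\tau v\in\mathcal D(A)\}$. $\sigma$ denotes the spectrum and $\sigma_p$ the point spectrum. *)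

theory Defs
  imports "HOL-Analysis.Analysis"
begin

text \<open>
  An unbounded operator is given by its domain \<open>D\<close> and a function \<open>A\<close>;
  the values of \<open>A\<close> outside \<open>D\<close> are irrelevant.
\<close>

definition linear_operator :: "'a::real_vector set \<Rightarrow> ('a \<Rightarrow> 'b::real_vector) \<Rightarrow> bool" where
  "linear_operator D A \<longleftrightarrow> subspace D \<and>
     (\<forall>x\<in>D. \<forall>y\<in>D. A (x + y) = A x + A y) \<and> (\<forall>x\<in>D. \<forall>r. A (r *\<^sub>R x) = r *\<^sub>R A x)"

definition graph_on :: "'a set \<Rightarrow> ('a \<Rightarrow> 'b) \<Rightarrow> ('a \<times> 'b) set" where
  "graph_on D A = (\<lambda>x. (x, A x)) ` D"

definition adjoint_graph :: "'h::real_inner set \<Rightarrow> ('h \<Rightarrow> 'h) \<Rightarrow> ('h \<times> 'h) set" where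
  "adjoint_graph D A = {(y, z). \<forall>x\<in>D. inner (A x) y = inner x z}"

definition self_adjoint :: "'h::real_inner set \<Rightarrow> ('h \<Rightarrow> 'h) \<Rightarrow> bool" where
  "self_adjoint D A \<longleftrightarrow>
     linear_operator D A \<and> closure D = UNIV \<and> adjoint_graph D A = graph_on D A"

definition positive_operator :: "'h::real_inner set \<Rightarrow> ('h \<Rightarrow> 'h) \<Rightarrow> bool" where
  "positive_operator D A \<longleftrightarrow> (\<forall>x\<in>D. x \<noteq> 0 \<longrightarrow> inner (A x) x > 0)"

text \<open>
  The complexification of a real vector space \<open>X\<close> is \<open>X \<times> X\<close>, the pair \<open>(x, y)\<close> standing for
  \<open>x + i y\<close>. If \<open>X\<close> is a Hilbert space with norm \<open>N\<close>, the norm of the complexified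
  Hilbert space is \<open>cnorm N\<close>; for \<open>N = norm\<close> this is the library norm on pairs.
\<close>

definition cscale :: "complex \<Rightarrow> 'a::real_vector \<times> 'a \<Rightarrow> 'a \<times> 'a" where
  "cscale z p = (Re z *\<^sub>R fst p - Im z *\<^sub>R snd p, Re z *\<^sub>R snd p + Im z *\<^sub>R fst p)"

definition cnorm :: "('a \<Rightarrow> real) \<Rightarrow> 'a \<times> 'a \<Rightarrow> real" where
  "cnorm N p = sqrt ((N (fst p))\<^sup>2 + (N (snd p))\<^sup>2)"

lemma cnorm_norm: "cnorm norm = norm"
  by (auto simp: cnorm_def norm_prod_def)

definition cop :: "('a \<Rightarrow> 'b) \<Rightarrow> 'a \<times> 'a \<Rightarrow> 'b \<times> 'b" where
  "cop T = map_prod T T"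

text \<open>
  Spectral notions for a real operator \<open>T\<close> with domain \<open>D\<close> acting in the real space \<open>X\<close> with
  norm \<open>N\<close>: they are those of the complexification of \<open>T\<close>, with domain \<open>D \<times> D\<close>, acting in
  \<open>X \<times> X\<close>.
\<close>

definition resolvent_set ::
  "'a::real_vector set \<Rightarrow> ('a \<Rightarrow> real) \<Rightarrow> 'a set \<Rightarrow> ('a \<Rightarrow> 'a) \<Rightarrow> complex set" where
  "resolvent_set X N D T = {z.
     bij_betw (\<lambda>p. cscale z p - cop T p) (D \<times> D) (X \<times> X) \<and>
     (\<exists>C. \<forall>p\<in>D \<times> D. cnorm N p \<le> C * cnorm N (cscale z p - cop T p))}"

definition resolvent ::
  "'a::real_vector set \<Rightarrow> ('a \<Rightarrow> 'a) \<Rightarrow> complex \<Rightarrow> 'a \<times> 'a \<Rightarrow> 'a \<times> 'a" where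
  "resolvent D T z = the_inv_into (D \<times> D) (\<lambda>p. cscale z p - cop T p)"

definition spectrum ::
  "'a::real_vector set \<Rightarrow> ('a \<Rightarrow> real) \<Rightarrow> 'a set \<Rightarrow> ('a \<Rightarrow> 'a) \<Rightarrow> complex set" where
  "spectrum X N D T = - resolvent_set X N D T"

definition point_spectrum :: "'a::real_vector set \<Rightarrow> ('a \<Rightarrow> 'a) \<Rightarrow> complex set" where
  "point_spectrum D T = {z. \<exists>p\<in>D \<times> D. p \<noteq> 0 \<and> cop T p = cscale z p}"

definition compact_resolvent :: "'h::real_inner set \<Rightarrow> ('h \<Rightarrow> 'h) \<Rightarrow> bool" where
  "compact_resolvent D A \<longleftrightarrow>
     (\<exists>z\<in>resolvent_set UNIV norm D A. \<forall>S. bounded S \<longrightarrow> compact (closure (resolvent D A z ` S)))"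

text \<open>
  The square root of a positive self-adjoint operator with compact resolvent, by its spectral
  resolution \<open>A = \<Sum>\<^sub>l l P\<^sub>l\<close>, where \<open>l\<close> runs through the (real) eigenvalues of \<open>A\<close> and \<open>P\<^sub>l\<close> is
  the orthogonal projection onto the eigenspace of \<open>l\<close>. Further, \<open>A\<^sup>3\<^sup>/\<^sup>2 = A\<^sup>1\<^sup>/\<^sup>2 A\<close> as a composition
  of unbounded operators, which fixes its domain.
\<close>

definition eigenspace :: "'h::real_inner set \<Rightarrow> ('h \<Rightarrow> 'h) \<Rightarrow> real \<Rightarrow> 'h set" where
  "eigenspace D A l = {x\<in>D. A x = l *\<^sub>R x}"

definition eigenvalues :: "'h::real_inner set \<Rightarrow> ('h \<Rightarrow> 'h) \<Rightarrow> real set" where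
  "eigenvalues D A = {l. eigenspace D A l \<noteq> {0}}"

definition orth_proj :: "'h::real_inner set \<Rightarrow> 'h \<Rightarrow> 'h" where
  "orth_proj M x = (THE y. y \<in> M \<and> (\<forall>m\<in>M. inner (x - y) m = 0))"

definition dom_sqrt :: "'h::real_inner set \<Rightarrow> ('h \<Rightarrow> 'h) \<Rightarrow> 'h set" where
  "dom_sqrt D A =
     {x. (\<lambda>l. (sqrt l * norm (orth_proj (eigenspace D A l) x))\<^sup>2) summable_on eigenvalues D A}"

definition op_sqrt :: "'h::real_inner set \<Rightarrow> ('h \<Rightarrow> 'h) \<Rightarrow> 'h \<Rightarrow> 'h" where
  "op_sqrt D A x = (\<Sum>\<^sub>\<infinity>l\<in>eigenvalues D A. sqrt l *\<^sub>R orth_proj (eigenspace D A l) x)"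

definition dom_three_halves :: "'h::real_inner set \<Rightarrow> ('h \<Rightarrow> 'h) \<Rightarrow> 'h set" where
  "dom_three_halves D A = {x \<in> D. A x \<in> dom_sqrt D A}"

text \<open>The space \<open>\<D>(A\<^sup>1\<^sup>/\<^sup>2) \<times> \<D>(A\<^sup>1\<^sup>/\<^sup>2)\<close> and the operator acting in its complexification.\<close>

definition H00 :: "'h::real_inner set \<Rightarrow> ('h \<Rightarrow> 'h) \<Rightarrow> ('h \<times> 'h) set" where
  "H00 D A = dom_sqrt D A \<times> dom_sqrt D A"

definition dom_limit_op ::
  "'h::real_inner set \<Rightarrow> ('h \<Rightarrow> 'h) \<Rightarrow> real \<Rightarrow> real \<Rightarrow> ('h \<times> 'h) set" where
  "dom_limit_op D A c \<delta> =
     {(u, v) \<in> H00 D A. c\<^sup>2 *\<^sub>R u + \<delta> *\<^sub>R v \<in> dom_three_halves D A}"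

definition limit_op ::
  "('h::real_inner \<Rightarrow> 'h) \<Rightarrow> real \<Rightarrow> real \<Rightarrow> real \<Rightarrow> 'h \<times> 'h \<Rightarrow> 'h \<times> 'h" where
  "limit_op A \<alpha> c \<delta> = (\<lambda>(u, v). (v, - (inverse \<alpha> *\<^sub>R A (c\<^sup>2 *\<^sub>R u + \<delta> *\<^sub>R v))))"

text \<open>The space \<open>\<D>(A\<^sup>1\<^sup>/\<^sup>2) \<times> \<D>(A\<^sup>1\<^sup>/\<^sup>2) \<times> H\<close> and the operator acting in its complexification.\<close>

definition H0 :: "'h::real_inner set \<Rightarrow> ('h \<Rightarrow> 'h) \<Rightarrow> ('h \<times> 'h \<times> 'h) set" where
  "H0 D A = dom_sqrt D A \<times> dom_sqrt D A \<times> UNIV"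

definition norm_H0 :: "'h::real_inner set \<Rightarrow> ('h \<Rightarrow> 'h) \<Rightarrow> 'h \<times> 'h \<times> 'h \<Rightarrow> real" where
  "norm_H0 D A = (\<lambda>(u, v, w).
     sqrt ((norm (op_sqrt D A u))\<^sup>2 + (norm (op_sqrt D A v))\<^sup>2 + (norm w)\<^sup>2))"

definition btau :: "real \<Rightarrow> real \<Rightarrow> real \<Rightarrow> real" where
  "btau c \<delta> \<tau> = \<delta> + \<tau> * c\<^sup>2"

definition dom_tau_op ::
  "'h::real_inner set \<Rightarrow> ('h \<Rightarrow> 'h) \<Rightarrow> real \<Rightarrow> real \<Rightarrow> real \<Rightarrow> ('h \<times> 'h \<times> 'h) set" where
  "dom_tau_op D A c \<delta> \<tau> =
     {(u, v, w) \<in> H0 D A. w \<in> dom_sqrt D A \<and> c\<^sup>2 *\<^sub>R u + btau c \<delta> \<tau> *\<^sub>R v \<in> D}"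

definition tau_op ::
  "('h::real_inner \<Rightarrow> 'h) \<Rightarrow> real \<Rightarrow> real \<Rightarrow> real \<Rightarrow> real
     \<Rightarrow> 'h \<times> 'h \<times> 'h \<Rightarrow> 'h \<times> 'h \<times> 'h" where
  "tau_op A \<alpha> c \<delta> \<tau> = (\<lambda>(u, v, w).
     (v, w, - (inverse \<tau> *\<^sub>R A (c\<^sup>2 *\<^sub>R u + btau c \<delta> \<tau> *\<^sub>R v)) - (inverse \<tau> * \<alpha>) *\<^sub>R w))"

end

theory Submission
  imports Defs "HOL-Computational_Algebra.Fundamental_Theorem_Algebra"
begin

text \<open>
  An eigenvector of the limit operator is \<open>(u, z\<^sub>0 u)\<close> with \<open>A u = \<mu> u\<close>, where
  \<open>\<alpha> z\<^sub>0\<^sup>2 + \<mu> (c\<^sup>2 + \<delta> z\<^sub>0) = 0\<close>; symmetry makes \<open>\<mu>\<close> real and gives a real eigenvector \<open>e\<close>.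
  Every root \<open>z\<close> of \<open>\<tau> z\<^sup>3 + \<alpha> z\<^sup>2 + b\<^sup>\<tau> \<mu> z + c\<^sup>2 \<mu>\<close> then yields the eigenvector
  \<open>(e, z e, z\<^sup>2 e)\<close> of the operator with parameter \<open>\<tau>\<close>. At \<open>z\<^sub>0\<close> the cubic has the value
  \<open>\<tau> (z\<^sub>0\<^sup>3 + c\<^sup>2 \<mu> z\<^sub>0)\<close>, so the product of the distances of its three roots to \<open>z\<^sub>0\<close> stays bounded,
  whereas the sum of the roots is \<open>- \<alpha> / \<tau>\<close>. Hence one root escapes to infinity as \<open>\<tau> \<rightarrow> 0\<close>, and
  another one must approach \<open>z\<^sub>0\<close>.
\<close>

section \<open>Complex scalars on complexified spaces\<close>

lemma cscale_cscale: "cscale z (cscale w p) = cscale (z * w) p"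
  by (simp add: cscale_def algebra_simps prod_eq_iff)

lemma cscale_one [simp]: "cscale 1 p = p"
  by (simp add: cscale_def)

lemma cscale_zero [simp]: "cscale 0 p = 0"
  by (simp add: cscale_def zero_prod_def)

lemma cscale_of_real: "cscale (of_real r) p = r *\<^sub>R p"
  by (simp add: cscale_def prod_eq_iff)

lemma cscale_eq_0_iff: "cscale z p = 0 \<longleftrightarrow> z = 0 \<or> p = 0"
proof (cases "z = 0")
  case False
  have "p = 0" if "cscale z p = 0"
  proof -
    have "p = cscale (inverse z) (cscale z p)"
      using False by (simp add: cscale_cscale)
    with that show ?thesis
      by (simp add: cscale_def zero_prod_def)
  qed
  then show ?thesis
    using False by (auto simp: cscale_def zero_prod_def)
qed simp

lemma cscale_in_complexification:
  assumes "subspace D" "p \<in> D \<times> D"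
  shows "cscale z p \<in> D \<times> D"
  using assms by (auto simp: cscale_def subspace_add subspace_diff subspace_scale)

lemma linear_operator_zero:
  assumes "linear_operator D A"
  shows "0 \<in> D" "A 0 = 0"
proof -
  show "0 \<in> D"
    using assms by (simp add: linear_operator_def subspace_0)
  then have "A (0 *\<^sub>R 0) = 0 *\<^sub>R A 0"
    using assms unfolding linear_operator_def by blast
  then show "A 0 = 0"
    by simp
qed

lemma linear_operator_diff:
  assumes "linear_operator D A" "x \<in> D" "y \<in> D"
  shows "A (x - y) = A x - A y"
proof -
  have D: "subspace D"
    and add: "\<And>x y. x \<in> D \<Longrightarrow> y \<in> D \<Longrightarrow> A (x + y) = A x + A y"
    using assms(1) by (auto simp: linear_operator_def)
  have "A ((x - y) + y) = A (x - y) + A y"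
    using assms(2,3) D by (intro add) (auto intro: subspace_diff)
  then show ?thesis
    by simp
qed

lemma cop_cscale:
  assumes "linear_operator D A" "p \<in> D \<times> D"
  shows "cop A (cscale z p) = cscale z (cop A p)"
proof -
  have D: "subspace D"
    and add: "\<And>x y. x \<in> D \<Longrightarrow> y \<in> D \<Longrightarrow> A (x + y) = A x + A y"
    and scale: "\<And>x r. x \<in> D \<Longrightarrow> A (r *\<^sub>R x) = r *\<^sub>R A x"
    using assms(1) by (auto simp: linear_operator_def)
  obtain x y where p: "p = (x, y)" "x \<in> D" "y \<in> D"
    using assms(2) by auto
  show ?thesis
    using p D
    by (simp add: cop_def cscale_def linear_operator_diff[OF assms(1)] add scale subspace_scale)
qed

text \<open>An eigenvector and 0 have the same image under \<open>z - T\<close>, so injectivity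
  fails. The two assumptions place 0 in the domain with value 0.\<close>

lemma point_spectrum_subset_spectrum:
  assumes "0 \<in> D" "T 0 = 0"
  shows "point_spectrum D T \<subseteq> spectrum X N D T"
proof
  fix z assume "z \<in> point_spectrum D T"
  then obtain p where p: "p \<in> D \<times> D" "p \<noteq> 0" "cop T p = cscale z p"
    by (auto simp: point_spectrum_def)
  have "0 \<in> D \<times> D" "cscale z 0 - cop T 0 = cscale z p - cop T p"
    using assms p(3) by (auto simp: cop_def cscale_def zero_prod_def)
  then have "\<not> inj_on (\<lambda>p. cscale z p - cop T p) (D \<times> D)"
    using p(1,2) by (metis (mono_tags, lifting) inj_onD)
  then show "z \<in> spectrum X N D T"
    by (auto simp: spectrum_def resolvent_set_def bij_betw_def)
qed

section \<open>Eigenvectors of self-adjoint operators\<close>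

lemma self_adjoint_symmetric:
  assumes "self_adjoint D A" "x \<in> D" "y \<in> D"
  shows "inner (A x) y = inner x (A y)"
proof -
  have "(y, A y) \<in> adjoint_graph D A"
    using assms by (auto simp: self_adjoint_def graph_on_def)
  then show ?thesis
    using assms(2) by (auto simp: adjoint_graph_def)
qed

text \<open>For an eigenvector \<open>x + i y\<close>, symmetry tested on \<open>x\<close> against
  \<open>y\<close> leaves \<open>Im z\<close> times the squared norm, so \<open>z\<close> is real.
  Then \<open>x\<close> and \<open>y\<close> both solve the real eigenvalue equation, and one of
  them is nonzero.\<close>

lemma self_adjoint_point_spectrum:
  assumes "self_adjoint D A" "z \<in> point_spectrum D A"
  obtains e where "z = of_real (Re z)" "e \<noteq> 0" "e \<in> eigenspace D A (Re z)"
proof -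
  obtain x y where xy: "x \<in> D" "y \<in> D" "(x, y) \<noteq> 0"
    and eq: "A x = Re z *\<^sub>R x - Im z *\<^sub>R y" "A y = Re z *\<^sub>R y + Im z *\<^sub>R x"
    using assms(2) by (auto simp: point_spectrum_def cop_def cscale_def)
  have "inner (A x) y = inner x (A y)"
    using self_adjoint_symmetric[OF assms(1) xy(1,2)] .
  then have "Im z * (inner x x + inner y y) = 0"
    by (simp add: eq inner_diff_left inner_add_right inner_commute algebra_simps)
  moreover have "inner x x + inner y y \<noteq> 0"
    using xy(3) by (simp add: add_nonneg_eq_0_iff zero_prod_def)
  ultimately have im: "Im z = 0"
    by simp
  have "x \<in> eigenspace D A (Re z)" "y \<in> eigenspace D A (Re z)"
    using xy eq im by (auto simp: eigenspace_def)
  moreover have "z = of_real (Re z)"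
    using im by (simp add: complex_eq_iff)
  moreover have "x \<noteq> 0 \<or> y \<noteq> 0"
    using xy(3) by (auto simp: zero_prod_def)
  ultimately show ?thesis
    using that by blast
qed

lemma eigenspace_orthogonal:
  assumes "self_adjoint D A" "x \<in> eigenspace D A l" "y \<in> eigenspace D A m" "l \<noteq> m"
  shows "inner x y = 0"
proof -
  have "inner (A x) y = inner x (A y)"
    using assms by (intro self_adjoint_symmetric) (auto simp: eigenspace_def)
  then show ?thesis
    using assms(2-4) by (simp add: eigenspace_def)
qed

text \<open>By orthogonality the projections onto all other eigenspaces vanish, so the series
  defining the domain has at most one nonzero term.\<close>

lemma eigenspace_subset_dom_sqrt:
  assumes "self_adjoint D A"
  shows "eigenspace D A l \<subseteq> dom_sqrt D A"
proof
  fix x assume x: "x \<in> eigenspace D A l"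
  have "orth_proj (eigenspace D A m) x = 0" if "m \<noteq> l" for m
    unfolding orth_proj_def
  proof (rule the_equality)
    have "0 \<in> eigenspace D A m"
      using assms by (auto simp: eigenspace_def self_adjoint_def linear_operator_zero)
    then show "0 \<in> eigenspace D A m \<and> (\<forall>y\<in>eigenspace D A m. inner (x - 0) y = 0)"
      using eigenspace_orthogonal[OF assms x] that by auto
  next
    fix y assume y: "y \<in> eigenspace D A m \<and> (\<forall>w\<in>eigenspace D A m. inner (x - y) w = 0)"
    \<comment> \<open>Uniqueness of the projection: \<open>y\<close> itself serves as test
      vector.\<close>
    then have "inner (x - y) y = 0" "inner x y = 0"
      using eigenspace_orthogonal[OF assms x] that by auto
    then show "y = 0"
      by (simp add: inner_diff_left)
  qed
  \<comment> \<open>The index set is an intersection because \<open>l\<close> need not be an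
    eigenvalue when \<open>x = 0\<close>.\<close>
  then have "(\<lambda>m. (sqrt m * norm (orth_proj (eigenspace D A m) x))\<^sup>2) summable_on eigenvalues D A
    \<longleftrightarrow> (\<lambda>m. (sqrt m * norm (orth_proj (eigenspace D A m) x))\<^sup>2) summable_on (eigenvalues D A \<inter> {l})"
    by (intro summable_on_cong_neutral) auto
  then show "x \<in> dom_sqrt D A"
    by (simp add: dom_sqrt_def summable_on_finite)
qed

section \<open>Eigenvalue equations of the limit operator and of the operator with parameter
  \<tau>\<close>

text \<open>The first component gives \<open>v = z u\<close>, the second
  \<open>A (\<kappa> u) = - \<alpha> z^2 u\<close> with \<open>\<kappa> = c^2 + \<delta> z\<close>.
  Dividing by \<kappa> makes \<open>u\<close> an eigenvector of \<open>A\<close>. The eigenvalue may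
  be complex at this stage.\<close>

lemma limit_op_point_spectrum:
  assumes "linear_operator D A" "\<alpha> \<noteq> 0" "c \<noteq> 0"
    and "z \<in> point_spectrum (dom_limit_op D A c \<delta>) (limit_op A \<alpha> c \<delta>)"
  obtains \<mu> where "\<mu> \<in> point_spectrum D A" "\<alpha> * z\<^sup>2 + \<mu> * (c\<^sup>2 + \<delta> * z) = 0"
proof -
  obtain u1 v1 u2 v2 where
    dom: "(u1, v1) \<in> dom_limit_op D A c \<delta>" "(u2, v2) \<in> dom_limit_op D A c \<delta>"
    and ne: "((u1, v1), (u2, v2)) \<noteq> 0"
    and eig: "cop (limit_op A \<alpha> c \<delta>) ((u1, v1), (u2, v2)) = cscale z ((u1, v1), (u2, v2))"
    using assms(4) unfolding point_spectrum_def by auto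
  \<comment> \<open>The eigenvector comes as a pair of real and imaginary parts; \<open>U\<close>
    and \<open>V\<close> regroup it into its complexified components.\<close>
  define U V \<kappa> where "U = (u1, u2)" and "V = (v1, v2)"
    and "\<kappa> = complex_of_real (c\<^sup>2) + of_real \<delta> * z"
  have V: "V = cscale z U"
    using eig by (auto simp: U_def V_def cop_def cscale_def limit_op_def)
  have Y: "cscale \<kappa> U = (c\<^sup>2 *\<^sub>R u1 + \<delta> *\<^sub>R v1, c\<^sup>2 *\<^sub>R u2 + \<delta> *\<^sub>R v2)"
  proof -
    have "v1 = Re z *\<^sub>R u1 - Im z *\<^sub>R u2" "v2 = Re z *\<^sub>R u2 + Im z *\<^sub>R u1"
      using V by (simp_all add: U_def V_def cscale_def)
    then show ?thesis
      by (simp only: U_def \<kappa>_def cscale_def) (simp add: algebra_simps)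
  qed
  then have Y_dom: "cscale \<kappa> U \<in> D \<times> D"
    using dom by (auto simp: dom_limit_op_def dom_three_halves_def)
  have "(- inverse \<alpha>) *\<^sub>R cop A (cscale \<kappa> U) = cscale z V"
    unfolding Y using eig by (auto simp: V_def cop_def limit_op_def cscale_def)
  then have "cscale z V = (- inverse \<alpha>) *\<^sub>R cop A (cscale \<kappa> U)"
    by simp
  then have "cop A (cscale \<kappa> U) = cscale (of_real (- \<alpha>)) (cscale z V)"
    using assms(2) by (simp only: cscale_of_real) simp
  then have AY: "cop A (cscale \<kappa> U) = cscale (- \<alpha> * z\<^sup>2) U"
    by (simp add: cscale_cscale V power2_eq_square mult.assoc)
  have U: "U \<noteq> 0"
    using ne V by (auto simp: U_def V_def cscale_def zero_prod_def)
  \<comment> \<open>If \<kappa> vanished, \<open>z^2 U\<close> would vanish too, hence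
    \<open>z = 0\<close>; but then \<kappa> equals \<open>c^2\<close>, which is nonzero.\<close>
  have \<kappa>: "\<kappa> \<noteq> 0"
  proof
    assume "\<kappa> = 0"
    then have "cscale (- \<alpha> * z\<^sup>2) U = 0"
      using AY linear_operator_zero[OF assms(1)] by (simp add: cop_def zero_prod_def)
    then have "z = 0"
      using U assms(2) by (simp add: cscale_eq_0_iff)
    with \<open>\<kappa> = 0\<close> assms(3) show False
      by (simp add: \<kappa>_def)
  qed
  define \<mu> where "\<mu> = inverse \<kappa> * (- \<alpha> * z\<^sup>2)"
  \<comment> \<open>The domain controls only the combination \<open>cscale \<kappa> U\<close>; this
    identity carries membership in the domain of \<open>A\<close> over to \<open>U\<close>.\<close>
  have U_eq: "U = cscale (inverse \<kappa>) (cscale \<kappa> U)"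
    using \<kappa> by (simp add: cscale_cscale)
  have "cop A U = cscale (inverse \<kappa>) (cop A (cscale \<kappa> U))"
    using cop_cscale[OF assms(1) Y_dom] U_eq by metis
  then have "cop A U = cscale \<mu> U"
    by (simp add: AY \<mu>_def cscale_cscale)
  moreover have "U \<in> D \<times> D"
    using cscale_in_complexification[OF _ Y_dom] U_eq assms(1)
    by (metis linear_operator_def)
  ultimately have "\<mu> \<in> point_spectrum D A"
    using U unfolding point_spectrum_def by blast
  moreover have "\<alpha> * z\<^sup>2 + \<mu> * (c\<^sup>2 + \<delta> * z) = 0"
    using \<kappa> by (simp add: \<mu>_def \<kappa>_def)
  ultimately show ?thesis
    by (rule that)
qed

text \<open>The eigenvector is \<open>(e, z e, z^2 e)\<close>: the first two components of the
  eigenvalue equation hold by its form, and the third is the cubic divided by \<tau>.\<close>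

lemma root_in_tau_op_spectrum:
  fixes z :: complex
  assumes "self_adjoint D A" "e \<in> eigenspace D A l" "e \<noteq> 0" "\<tau> \<noteq> 0"
    and root: "\<tau> * z ^ 3 + \<alpha> * z\<^sup>2 + btau c \<delta> \<tau> * l * z + c\<^sup>2 * l = 0"
  shows "z \<in> spectrum X N (dom_tau_op D A c \<delta> \<tau>) (tau_op A \<alpha> c \<delta> \<tau>)"
proof -
  have lin: "linear_operator D A"
    using assms(1) by (simp add: self_adjoint_def)
  have e: "e \<in> D" "A e = l *\<^sub>R e"
    using assms(2) by (auto simp: eigenspace_def)
  have A_scale: "A (r *\<^sub>R e) = (r * l) *\<^sub>R e" for r
    using lin e by (simp add: linear_operator_def)
  have e_D: "r *\<^sub>R e \<in> D" for r
    using lin e by (simp add: linear_operator_def subspace_scale)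
  have e_sqrt: "r *\<^sub>R e \<in> dom_sqrt D A" for r
    using eigenspace_subset_dom_sqrt[OF assms(1), of l] e e_D A_scale
    by (auto simp: eigenspace_def)
  \<comment> \<open>Triples of real multiples of \<open>e\<close> form an invariant subspace, on
    which the operator acts by a companion matrix on the coefficients.\<close>
  define vec where "vec a b d = (a *\<^sub>R e, b *\<^sub>R e, d *\<^sub>R e)" for a b d :: real
  have vec_dom: "vec a b d \<in> dom_tau_op D A c \<delta> \<tau>" for a b d
    using e_sqrt e_D[of "c\<^sup>2 * a + btau c \<delta> \<tau> * b"]
    by (simp add: vec_def dom_tau_op_def H0_def scaleR_add_left)
  have vec_op: "tau_op A \<alpha> c \<delta> \<tau> (vec a b d) =
      vec b d (- (inverse \<tau> * (c\<^sup>2 * a + btau c \<delta> \<tau> * b) * l) - inverse \<tau> * \<alpha> * d)" for a b d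
    using A_scale[of "c\<^sup>2 * a + btau c \<delta> \<tau> * b"]
    by (simp add: vec_def tau_op_def scaleR_add_left scaleR_diff_left mult.assoc)
  have zero: "0 \<in> dom_tau_op D A c \<delta> \<tau>" "tau_op A \<alpha> c \<delta> \<tau> 0 = 0"
    using vec_dom[of 0 0 0] vec_op[of 0 0 0] by (simp_all add: vec_def zero_prod_def)
  \<comment> \<open>Real and imaginary parts of the coefficients \<open>(1, z, z^2)\<close>.\<close>
  define p where "p = (vec 1 (Re z) (Re (z\<^sup>2)), vec 0 (Im z) (Im (z\<^sup>2)))"
  have cube: "z * z\<^sup>2 = - (inverse \<tau> * (c\<^sup>2 + btau c \<delta> \<tau> * z) * l) - inverse \<tau> * \<alpha> * z\<^sup>2"
  proof -
    have "z * z\<^sup>2 = inverse \<tau> * (\<tau> * z ^ 3)"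
      using assms(4) by (simp add: power3_eq_cube power2_eq_square)
    also have "\<tau> * z ^ 3 = - (\<alpha> * z\<^sup>2 + btau c \<delta> \<tau> * l * z + c\<^sup>2 * l)"
      using root by (simp add: algebra_simps eq_neg_iff_add_eq_0)
    also have "inverse \<tau> * - (\<alpha> * z\<^sup>2 + btau c \<delta> \<tau> * l * z + c\<^sup>2 * l) =
        - (inverse \<tau> * (c\<^sup>2 + btau c \<delta> \<tau> * z) * l) - inverse \<tau> * \<alpha> * z\<^sup>2"
      by (simp add: algebra_simps)
    finally show ?thesis .
  qed
  \<comment> \<open>The factors 1 and 0 are the real and imaginary parts of the first coefficient,
    kept so that both lines match \<open>vec_op\<close> literally.\<close>
  have "Re (z * z\<^sup>2) = - (inverse \<tau> * (c\<^sup>2 * 1 + btau c \<delta> \<tau> * Re z) * l) - inverse \<tau> * \<alpha> * Re (z\<^sup>2)"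
    "Im (z * z\<^sup>2) = - (inverse \<tau> * (c\<^sup>2 * 0 + btau c \<delta> \<tau> * Im z) * l) - inverse \<tau> * \<alpha> * Im (z\<^sup>2)"
    unfolding cube by (simp_all flip: of_real_inverse of_real_power of_real_mult)
  then have "cop (tau_op A \<alpha> c \<delta> \<tau>) p =
      (vec (Re z) (Re (z\<^sup>2)) (Re (z * z\<^sup>2)), vec (Im z) (Im (z\<^sup>2)) (Im (z * z\<^sup>2)))"
    by (simp only: p_def cop_def map_prod_simp vec_op)
  also have "\<dots> = cscale z p"
    by (simp add: p_def cscale_def vec_def power2_eq_square flip: scaleR_add_left scaleR_diff_left)
  finally have "cop (tau_op A \<alpha> c \<delta> \<tau>) p = cscale z p" .
  moreover have "p \<noteq> 0"
    using assms(3) by (simp add: p_def vec_def zero_prod_def)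
  moreover have "p \<in> dom_tau_op D A c \<delta> \<tau> \<times> dom_tau_op D A c \<delta> \<tau>"
    using vec_dom by (simp add: p_def)
  ultimately have "z \<in> point_spectrum (dom_tau_op D A c \<delta> \<tau>) (tau_op A \<alpha> c \<delta> \<tau>)"
    unfolding point_spectrum_def by blast
  then show ?thesis
    using point_spectrum_subset_spectrum zero by blast
qed

section \<open>Roots of complex cubics\<close>

lemma cubic_factorization:
  fixes a b c d :: complex
  assumes "a \<noteq> 0"
  obtains x y w where "\<And>z. a * z ^ 3 + b * z\<^sup>2 + c * z + d = a * ((z - x) * (z - y) * (z - w))"
    "b = - a * (x + y + w)"
proof -
  let ?p = "[:d, c, b, a:]"
  obtain M where M: "size M = degree ?p" "?p = smult (lead_coeff ?p) (\<Prod>x\<in>#M. [:- x, 1:])"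
    using alg_closed_imp_factorization[of ?p] assms by auto
  have "size M = Suc (Suc (Suc 0))"
    using M(1) assms by simp
  then obtain x y w where "M = {#x, y, w#}"
    by (metis size_eq_Suc_imp_eq_union size_add_mset nat.inject size_eq_0_iff_empty)
  then have p: "?p = smult a ([:- x, 1:] * [:- y, 1:] * [:- w, 1:])"
    using M(2) assms by (simp add: algebra_simps)
  show ?thesis
  proof (rule that)
    show "a * z ^ 3 + b * z\<^sup>2 + c * z + d = a * ((z - x) * (z - y) * (z - w))" for z
      using arg_cong[OF p, of "\<lambda>q. poly q z"]
      by (simp add: power3_eq_cube power2_eq_square algebra_simps)
    \<comment> \<open>Vieta's formula, read off from the coefficients of degree 2.\<close>
    show "b = - a * (x + y + w)"
      using arg_cong[OF p, of "\<lambda>q. coeff q 2"] by (simp add: numeral_2_eq_2 algebra_simps)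
  qed
qed

text \<open>Some root \<open>r\<close> has at least a third of the modulus of the sum of the roots,
  so \<open>cmod r\<close> is at least \<open>cmod b / (3 * cmod a)\<close> and \<open>r\<close> is
  far from \<open>z0\<close>. If the other two roots also stayed at distance \<epsilon> or more, the
  factorized value at \<open>z0\<close> would exceed the bound \<open>small\<close>.\<close>

lemma cubic_root_near:
  fixes a b c d z0 :: complex
  assumes "a \<noteq> 0" "\<epsilon> > 0"
    and small: "cmod (a * z0 ^ 3 + b * z0\<^sup>2 + c * z0 + d) < (cmod b / 3 - cmod a * cmod z0) * \<epsilon>\<^sup>2"
  obtains z where "a * z ^ 3 + b * z\<^sup>2 + c * z + d = 0" "cmod (z - z0) < \<epsilon>"
proof -
  obtain x y w where fact: "\<And>z. a * z ^ 3 + b * z\<^sup>2 + c * z + d = a * ((z - x) * (z - y) * (z - w))"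
    and b: "b = - a * (x + y + w)"
    using cubic_factorization[OF assms(1)] by metis
  have "\<exists>z\<in>{x, y, w}. cmod (z - z0) < \<epsilon>"
  proof (rule ccontr)
    assume "\<not> ?thesis"
    then have far: "\<epsilon> \<le> cmod (z0 - x)" "\<epsilon> \<le> cmod (z0 - y)" "\<epsilon> \<le> cmod (z0 - w)"
      by (auto simp: norm_minus_commute)
    have bound: "cmod b / 3 - cmod a * cmod z0 \<le> cmod a * cmod (z0 - r)"
      if "cmod (x + y + w) \<le> 3 * cmod r" for r
    proof -
      have "cmod b \<le> cmod a * (3 * cmod r)"
        unfolding b norm_mult norm_minus_cancel using that by (intro mult_left_mono) auto
      moreover have "cmod a * cmod r \<le> cmod a * (cmod z0 + cmod (z0 - r))"
        using norm_triangle_sub[of r z0] by (intro mult_left_mono) (auto simp: norm_minus_commute)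
      ultimately show ?thesis
        by (simp add: algebra_simps)
    qed
    have far2: "\<epsilon>\<^sup>2 \<le> cmod (z0 - r) * cmod (z0 - s)" if "r \<in> {x, y, w}" "s \<in> {x, y, w}" for r s
      unfolding power2_eq_square using that far assms(2) by (intro mult_mono) auto
    have prod: "(cmod b / 3 - cmod a * cmod z0) * \<epsilon>\<^sup>2
        \<le> cmod a * cmod (z0 - r) * (cmod (z0 - s) * cmod (z0 - t))"
      if "cmod (x + y + w) \<le> 3 * cmod r" "s \<in> {x, y, w}" "t \<in> {x, y, w}" for r s t
    proof -
      have "(cmod b / 3 - cmod a * cmod z0) * \<epsilon>\<^sup>2 \<le> cmod a * cmod (z0 - r) * \<epsilon>\<^sup>2"
        using bound[OF that(1)] by (intro mult_right_mono) auto
      also have "\<dots> \<le> cmod a * cmod (z0 - r) * (cmod (z0 - s) * cmod (z0 - t))"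
        using far2[OF that(2,3)] by (intro mult_left_mono) auto
      finally show ?thesis .
    qed
    have "cmod (x + y + w) \<le> cmod x + cmod y + cmod w"
      \<comment> \<open>The triangle inequality forces at least one root to carry a third of the
        sum.\<close>
      by (meson norm_triangle_mono norm_triangle_ineq order_refl)
    then consider "cmod (x + y + w) \<le> 3 * cmod x" | "cmod (x + y + w) \<le> 3 * cmod y"
      | "cmod (x + y + w) \<le> 3 * cmod w"
      by linarith
    then have "(cmod b / 3 - cmod a * cmod z0) * \<epsilon>\<^sup>2
        \<le> cmod (a * ((z0 - x) * (z0 - y) * (z0 - w)))"
    proof cases
      case 1
      then show ?thesis using prod[of x y w] by (simp add: norm_mult mult_ac)
    next
      case 2
      then show ?thesis using prod[of y x w] by (simp add: norm_mult mult_ac)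
    next
      case 3
      then show ?thesis using prod[of w x y] by (simp add: norm_mult mult_ac)
    qed
    with small show False
      by (simp add: fact)
  qed
  then show ?thesis
    using that fact by auto
qed

theorem corollary2p6:
  fixes D :: "'h::{real_inner, banach} set"
    and A :: "'h \<Rightarrow> 'h"
    and \<alpha> c \<delta> \<epsilon> :: real
  assumes separable: "separable_space (euclidean :: 'h topology)"
    and infinite_dim: "\<nexists>B :: 'h set. finite B \<and> span B = UNIV"
    and self_adjoint: "self_adjoint D A"
    and positive: "positive_operator D A"
    and compact_resolvent: "compact_resolvent D A"
    and pos: "\<alpha> > 0" "c > 0" "\<delta> > 0" "\<epsilon> > 0"
  shows "\<forall>z0 \<in> point_spectrum (dom_limit_op D A c \<delta>) (limit_op A \<alpha> c \<delta>).
    \<exists>\<eta>>0. \<exists>\<tau>\<in>{0<..<\<eta>}.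
      {z \<in> spectrum (H0 D A) (norm_H0 D A) (dom_tau_op D A c \<delta> \<tau>) (tau_op A \<alpha> c \<delta> \<tau>).
         cmod (z - z0) < \<epsilon>} \<noteq> {}"
proof
  fix z0 assume z0: "z0 \<in> point_spectrum (dom_limit_op D A c \<delta>) (limit_op A \<alpha> c \<delta>)"
  have "linear_operator D A"
    using self_adjoint by (simp add: self_adjoint_def)
  then obtain \<mu> where \<mu>: "\<mu> \<in> point_spectrum D A" "\<alpha> * z0\<^sup>2 + \<mu> * (c\<^sup>2 + \<delta> * z0) = 0"
    using limit_op_point_spectrum[OF _ _ _ z0] pos by auto
  obtain e where e: "e \<noteq> 0" "e \<in> eigenspace D A (Re \<mu>)" and "\<mu> = of_real (Re \<mu>)"
    using self_adjoint_point_spectrum[OF self_adjoint \<mu>(1)] by blast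
  define l where "l = Re \<mu>"
  have limit_eq: "\<alpha> * z0\<^sup>2 + l * (c\<^sup>2 + \<delta> * z0) = 0"
    using \<mu>(2) \<open>\<mu> = of_real (Re \<mu>)\<close> by (simp add: l_def)
  define K where "K = cmod (z0 ^ 3 + c\<^sup>2 * l * z0)"
  \<comment> \<open>The smallness condition of \<open>cubic_root_near\<close>, written as the
    negativity of one function. Its limit at 0 is \<open>- \<alpha> \<epsilon>^2 / 3\<close>, so it
    holds for all small positive \<tau>.\<close>
  have "((\<lambda>\<tau>. \<tau> * K - (\<alpha> / 3 - \<tau> * cmod z0) * \<epsilon>\<^sup>2) \<longlongrightarrow> 0 * K - (\<alpha> / 3 - 0 * cmod z0) * \<epsilon>\<^sup>2)
      (at_right 0)"
    by (intro tendsto_intros)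
  moreover have "0 * K - (\<alpha> / 3 - 0 * cmod z0) * \<epsilon>\<^sup>2 < 0"
    using pos by simp
  ultimately have "\<forall>\<^sub>F \<tau> in at_right 0. \<tau> * K - (\<alpha> / 3 - \<tau> * cmod z0) * \<epsilon>\<^sup>2 < 0"
    by (rule order_tendstoD)
  moreover have "\<forall>\<^sub>F \<tau> :: real in at_right 0. \<tau> > 0"
    by (rule eventually_at_right_less)
  ultimately have "\<forall>\<^sub>F \<tau> in at_right 0. \<tau> > 0 \<and> \<tau> * K - (\<alpha> / 3 - \<tau> * cmod z0) * \<epsilon>\<^sup>2 < 0"
    by eventually_elim simp
  then obtain \<tau> where \<tau>: "\<tau> > 0" and "\<tau> * K - (\<alpha> / 3 - \<tau> * cmod z0) * \<epsilon>\<^sup>2 < 0"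
    using eventually_happens'[OF trivial_limit_at_right_real] by blast
  then have small: "\<tau> * K < (\<alpha> / 3 - \<tau> * cmod z0) * \<epsilon>\<^sup>2"
    by simp
  \<comment> \<open>As \<open>btau\<close> is \<delta> plus \<tau> times \<open>c^2\<close>, the
    cubic splits into a multiple of \<tau> and the limit equation, which vanishes at
    \<open>z0\<close>.\<close>
  have "\<tau> * z0 ^ 3 + \<alpha> * z0\<^sup>2 + btau c \<delta> \<tau> * l * z0 + c\<^sup>2 * l =
      \<tau> * (z0 ^ 3 + c\<^sup>2 * l * z0) + (\<alpha> * z0\<^sup>2 + l * (c\<^sup>2 + \<delta> * z0))"
    by (simp add: btau_def algebra_simps)
  then have "cmod (\<tau> * z0 ^ 3 + \<alpha> * z0\<^sup>2 + btau c \<delta> \<tau> * l * z0 + c\<^sup>2 * l) = \<tau> * K"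
    using \<tau> by (simp add: limit_eq K_def norm_mult del: of_real_power)
  then have "cmod (\<tau> * z0 ^ 3 + \<alpha> * z0\<^sup>2 + btau c \<delta> \<tau> * l * z0 + c\<^sup>2 * l)
      < (cmod \<alpha> / 3 - cmod \<tau> * cmod z0) * \<epsilon>\<^sup>2"
    using small \<tau> pos by simp
  then obtain z :: complex where z:
    "\<tau> * z ^ 3 + \<alpha> * z\<^sup>2 + btau c \<delta> \<tau> * l * z + c\<^sup>2 * l = 0" "cmod (z - z0) < \<epsilon>"
    using cubic_root_near[of \<tau> \<epsilon> z0 \<alpha> "btau c \<delta> \<tau> * l" "c\<^sup>2 * l"] \<tau> pos by auto
  have "z \<in> spectrum (H0 D A) (norm_H0 D A) (dom_tau_op D A c \<delta> \<tau>) (tau_op A \<alpha> c \<delta> \<tau>)"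
    using root_in_tau_op_spectrum[OF self_adjoint e(2,1), of \<tau> z] z(1) \<tau> by (simp add: l_def)
  then show "\<exists>\<eta>>0. \<exists>\<tau>\<in>{0<..<\<eta>}.
      {z \<in> spectrum (H0 D A) (norm_H0 D A) (dom_tau_op D A c \<delta> \<tau>) (tau_op A \<alpha> c \<delta> \<tau>).
         cmod (z - z0) < \<epsilon>} \<noteq> {}"
    \<comment> \<open>Since \<tau> is chosen first, any bound above it serves as \<eta>; here it is
      twice \<tau>.\<close>
    using z(2) \<tau> by (intro exI[of _ "2 * \<tau>"] conjI bexI[of _ \<tau>]) auto
qed

end
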